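(* Let $I\subset\mathbb{R}$ be an interval with interior $I^{o}$, let $f:I^{o}\to\mathbb{R}$ be differentiable on $I^{o}$, let $a,b\in I^{o}$ with $a<b$, and let $p>1$ be a real number. If $|f'|^{\frac{p}{p-1}}$ is quasi-convex on $[a,b]$, then for every $x\in[a,b]$ the following inequality holds: $$\left|\frac{(b-x)f(b)+(x-a)f(a)}{b-a}-\frac{1}{b-a}\int_{a}^{b}f(u)\,du\right|\le \frac{(x-a)^{2}}{b-a}\left(\frac{1}{p+1}\right)^{\frac1p}\left(\max\left\{|f'(x)|^{\frac{p}{p-1}},|f'(a)|^{\frac{p}{p-1}}\right\}\right)^{\frac{p-1}{p}}+\frac{(b-x)^{2}}{b-a}\left(\frac{1}{p+1}\right)^{\frac1p}\left(\max\left\{|f'(x)|^{\frac{p}{p-1}},|f'(b)|^{\frac{p}{p-1}}\right\}\right)^{\frac{p-1}{p}}.$$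
   Context: A function $g:[a,b]\to\mathbb{R}$ is called quasi-convex on $[a,b]$ if $g(\lambda u+(1-\lambda)v)\le\max\{g(u),g(v)\}$ for all $u,v\in[a,b]$ and all $\lambda\in[0,1]$. *)

theory Defs
  imports "HOL-Analysis.Analysis"
begin

definition quasi_convex_on :: "real set \<Rightarrow> (real \<Rightarrow> real) \<Rightarrow> bool" where
  "quasi_convex_on S g \<longleftrightarrow>
     (\<forall>u\<in>S. \<forall>v\<in>S. \<forall>t\<in>{0..1}. g (t * u + (1 - t) * v) \<le> max (g u) (g v))"

end

theory Submission
  imports Defs
begin

text \<open>
  Quasi-convexity bounds \<open>\<bar>f'\<bar>\<close> on each of \<open>[a, x]\<close> and \<open>[x, b]\<close> by its larger endpoint value, so
  \<open>f\<close> is Lipschitz there and the two halves of the left-hand side, such as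
  \<open>(x - a) f(a) - \<integral>\<^sub>a\<^sup>x f = \<integral>\<^sub>a\<^sup>x (f(a) - f(u)) du\<close>, are estimated directly with the constant \<open>1/2\<close>.
  This is sharper than the constant \<open>(1/(p + 1))\<^sup>1\<^sup>/\<^sup>p\<close> that comes from Hoelder's inequality,
  because \<open>p + 1 \<le> 2\<^sup>p\<close>.
\<close>

text \<open>Weighted AM-GM for \<open>p + 1\<close> and \<open>1\<close> with weights
  \<open>1 / p\<close> and \<open>1 - 1 / p\<close>: the arithmetic mean is exactly
  \<open>2\<close>.\<close>

lemma half_le_powr_inverse:
  fixes p :: real
  assumes "p > 1"
  shows "1 / 2 \<le> (1 / (p + 1)) powr (1 / p)"
proof -
  have "(p + 1) powr (1 / p) * 1 powr (1 - 1 / p) \<le> 1 / p * (p + 1) + (1 - 1 / p) * 1"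
    by (rule Youngs_inequality_0) (use assms in auto)
  also have "\<dots> = 2"
    using assms by (simp add: field_simps)
  finally have "(p + 1) powr (1 / p) \<le> 2"
    by simp
  then have "1 / 2 \<le> 1 / (p + 1) powr (1 / p)"
    using assms by (intro divide_left_mono) auto
  then show ?thesis
    using assms by (simp add: powr_divide)
qed

lemma quasi_convex_on_segment:
  assumes "quasi_convex_on S g" "u \<in> S" "v \<in> S" "t \<in> closed_segment u v"
  shows "g t \<le> max (g u) (g v)"
proof -
  obtain s where "0 \<le> s" "s \<le> 1" "t = (1 - s) * u + s * v"
    using assms(4) by (auto simp: in_segment)
  \<comment> \<open>Here \<open>s\<close> weights the second endpoint, whereas the definition
    weights the first, so it is applied to \<open>v\<close> and \<open>u\<close> in swapped
    order.\<close>
  then show ?thesis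
    using assms(1-3) unfolding quasi_convex_on_def
    by (metis add.commute atLeastAtMost_iff max.commute)
qed

text \<open>The two exponents are reciprocal and positive, so a bound on a power of
  \<open>\<bar>f'\<bar>\<close> becomes a bound on \<open>\<bar>f'\<bar>\<close> itself.\<close>

lemma le_powr_of_powr_le:
  fixes p y m :: real
  assumes "p > 1" "y \<ge> 0" "y powr (p / (p - 1)) \<le> m"
  shows "y \<le> m powr ((p - 1) / p)"
proof -
  have "y = (y powr (p / (p - 1))) powr ((p - 1) / p)"
    using assms(1,2) by (simp add: powr_powr)
  also have "\<dots> \<le> m powr ((p - 1) / p)"
    using assms by (intro powr_mono2) auto
  finally show ?thesis .
qed

text \<open>The derivative bound makes \<open>f\<close> Lipschitz with constant \<open>K\<close>,
  and integrating \<open>K * \<bar>c - u\<bar>\<close> gives the right-hand side. Letting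
  \<open>c\<close> be either endpoint covers both halves of the main estimate.\<close>

lemma endpoint_rule_error:
  fixes f :: "real \<Rightarrow> real"
  assumes "l \<le> r" "c \<in> {l, r}"
    and diff: "\<And>t. t \<in> {l..r} \<Longrightarrow> (f has_real_derivative deriv f t) (at t)"
    and bound: "\<And>t. t \<in> {l..r} \<Longrightarrow> \<bar>deriv f t\<bar> \<le> K"
  shows "\<bar>(r - l) * f c - integral {l..r} f\<bar> \<le> K * (r - l)\<^sup>2 / 2"
proof -
  have "continuous_on {l..r} f"
    by (meson DERIV_isCont continuous_at_imp_continuous_on diff)
  then have f_int: "f integrable_on {l..r}"
    by (rule integrable_continuous_real)
  have lip: "\<bar>f c - f u\<bar> \<le> K * \<bar>c - u\<bar>" if "u \<in> {l..r}" for u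
  proof -
    have "norm (f c - f u) \<le> K * norm (c - u)"
      by (rule field_differentiable_bound[of "{l..r}" f "deriv f"])
        (use assms that in \<open>auto intro: has_field_derivative_at_within\<close>)
    then show ?thesis
      by simp
  qed
  have abs_int: "((\<lambda>u. K * \<bar>c - u\<bar>) has_integral K * (r - l)\<^sup>2 / 2) {l..r}"
  \<comment> \<open>As \<open>c\<close> is an endpoint, \<open>c - u\<close> keeps one sign, so the
    absolute value drops out and a quadratic antiderivative is available.\<close>
  proof (cases "c = l")
    case True
    have "((\<lambda>u. K * (u - l)) has_integral K * (r - l)\<^sup>2 / 2 - K * (l - l)\<^sup>2 / 2) {l..r}"
      by (rule fundamental_theorem_of_calculus[OF \<open>l \<le> r\<close>])
        (auto intro!: derivative_eq_intros simp flip: has_real_derivative_iff_has_vector_derivative)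
    then show ?thesis
      by (rule has_integral_eq_rhs[OF has_integral_eq[rotated]]) (use True in auto)
  next
    case False
    then have "c = r"
      using assms(2) by simp
    have "((\<lambda>u. K * (r - u)) has_integral - K * (r - r)\<^sup>2 / 2 - - K * (r - l)\<^sup>2 / 2) {l..r}"
      by (rule fundamental_theorem_of_calculus[OF \<open>l \<le> r\<close>])
        (auto intro!: derivative_eq_intros simp: field_simps simp flip: has_real_derivative_iff_has_vector_derivative)
    then show ?thesis
      by (rule has_integral_eq_rhs[OF has_integral_eq[rotated]]) (use \<open>c = r\<close> in auto)
  qed
  have "(r - l) * f c - integral {l..r} f = integral {l..r} (\<lambda>u. f c - f u)"
    using f_int assms(1) by (subst integral_diff) auto
  also have "\<bar>\<dots>\<bar> \<le> integral {l..r} (\<lambda>u. K * \<bar>c - u\<bar>)"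
    unfolding real_norm_def[symmetric]
    by (rule integral_norm_bound_integral)
      (use f_int abs_int lip in \<open>auto intro: integrable_diff\<close>)
  also have "\<dots> = K * (r - l)\<^sup>2 / 2"
    using abs_int by (rule integral_unique)
  finally show ?thesis .
qed

theorem theorem7:
  fixes I :: "real set" and f :: "real \<Rightarrow> real" and a b p x :: real
  assumes "is_interval I"
    and "f differentiable_on interior I"
    and "a \<in> interior I" and "b \<in> interior I" and "a < b"
    and "p > 1"
    and "quasi_convex_on {a..b} (\<lambda>t. \<bar>deriv f t\<bar> powr (p / (p - 1)))"
    and "x \<in> {a..b}"
  shows "\<bar>((b - x) * f b + (x - a) * f a) / (b - a) - 1 / (b - a) * integral {a..b} f\<bar>
    \<le> (x - a)\<^sup>2 / (b - a) * (1 / (p + 1)) powr (1 / p)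
        * (max (\<bar>deriv f x\<bar> powr (p / (p - 1))) (\<bar>deriv f a\<bar> powr (p / (p - 1)))) powr ((p - 1) / p)
      + (b - x)\<^sup>2 / (b - a) * (1 / (p + 1)) powr (1 / p)
        * (max (\<bar>deriv f x\<bar> powr (p / (p - 1))) (\<bar>deriv f b\<bar> powr (p / (p - 1)))) powr ((p - 1) / p)"
proof -
  \<comment> \<open>\<open>K a\<close> and \<open>K b\<close> will be the Lipschitz constants of
    \<open>f\<close> on \<open>[a, x]\<close> and \<open>[x, b]\<close>.\<close>
  define K where "K y = (max (\<bar>deriv f x\<bar> powr (p / (p - 1))) (\<bar>deriv f y\<bar> powr (p / (p - 1))))
    powr ((p - 1) / p)" for y
  define C where "C = (1 / (p + 1)) powr (1 / p)"
  have "convex (interior I)"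
    using assms(1) by (simp add: convex_interior is_interval_convex_1)
  then have sub: "{a..b} \<subseteq> interior I"
    using assms(3-5) by (metis closed_segment_eq_real_ivl1 closed_segment_subset less_imp_le)
  have deriv: "(f has_real_derivative deriv f t) (at t)" if "t \<in> {a..b}" for t
    using assms(2) sub that open_interior
    by (metis DERIV_deriv_iff_real_differentiable at_within_open differentiable_on_def subsetD)
  \<comment> \<open>The unoriented segment serves both \<open>y = a\<close>, to the left of
    \<open>x\<close>, and \<open>y = b\<close>, to its right.\<close>
  have bound: "\<bar>deriv f t\<bar> \<le> K y" if "y \<in> {a..b}" "t \<in> closed_segment x y" for t y
    using quasi_convex_on_segment[OF assms(7,8) that] assms(6)
    unfolding K_def by (intro le_powr_of_powr_le) auto
  have left: "\<bar>(x - a) * f a - integral {a..x} f\<bar> \<le> K a * (x - a)\<^sup>2 / 2"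
    using assms(5,8) by (intro endpoint_rule_error deriv bound) (auto simp: closed_segment_eq_real_ivl)
  have right: "\<bar>(b - x) * f b - integral {x..b} f\<bar> \<le> K b * (b - x)\<^sup>2 / 2"
    using assms(5,8) by (intro endpoint_rule_error deriv bound) (auto simp: closed_segment_eq_real_ivl)
  \<comment> \<open>This weakens the sharper constant \<open>1 / 2\<close> to \<open>C\<close>,
    using that \<open>K y\<close> is nonnegative.\<close>
  have half: "K y * s\<^sup>2 / 2 \<le> s\<^sup>2 * C * K y" for y s
    using mult_left_mono[OF half_le_powr_inverse[OF assms(6)], of "s\<^sup>2 * K y"]
    by (simp add: K_def C_def mult_ac)
  have "continuous_on {a..b} f"
    by (meson DERIV_isCont continuous_at_imp_continuous_on deriv)
  then have "integral {a..x} f + integral {x..b} f = integral {a..b} f"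
    using assms(8) by (intro Henstock_Kurzweil_Integration.integral_combine integrable_continuous_real) auto
  \<comment> \<open>With the integral split at \<open>x\<close>, this is the triangle inequality for
    the two one-sided errors.\<close>
  then have "\<bar>(b - x) * f b + (x - a) * f a - integral {a..b} f\<bar>
      \<le> (x - a)\<^sup>2 * C * K a + (b - x)\<^sup>2 * C * K b"
    using left right half[of a "x - a"] half[of b "b - x"] by linarith
  then have "\<bar>(b - x) * f b + (x - a) * f a - integral {a..b} f\<bar> / (b - a)
      \<le> ((x - a)\<^sup>2 * C * K a + (b - x)\<^sup>2 * C * K b) / (b - a)"
    using assms(5) by (intro divide_right_mono) auto
  moreover have "\<bar>((b - x) * f b + (x - a) * f a) / (b - a) - 1 / (b - a) * integral {a..b} f\<bar>
      = \<bar>(b - x) * f b + (x - a) * f a - integral {a..b} f\<bar> / (b - a)"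
    using assms(5) by (simp add: diff_divide_distrib[symmetric])
  ultimately show ?thesis
    by (simp add: K_def C_def add_divide_distrib)
qed

end
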